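(* Define the classes $\mathcal{F}_1=\{f\in\mathcal{A}:\operatorname{Re}(f(z)/g(z))>0 \text{ and } \operatorname{Re}(g(z)/(z+z^2/2))>0 \text{ for all } z\in\mathbb{D}, \text{ for some } g\in\mathcal{A}\}$, $\mathcal{F}_2=\{f\in\mathcal{A}:|f(z)/g(z)-1|<1 \text{ and } \operatorname{Re}(g(z)/(z+z^2/2))>0 \text{ for all } z\in\mathbb{D}, \text{ for some } g\in\mathcal{A}\}$, $\mathcal{F}_3=\{f\in\mathcal{A}:\operatorname{Re}(f(z)/(z+z^2/2))>0 \text{ for all } z\in\mathbb{D}\}$, and the polynomials $P_1(r)=1-5r+r^2+r^3$, $P_2(r)=2-8r-r^2+3r^3$, $P_3(r)=1-3r+r^3$. Then for each $i\in\{1,2,3\}$ the radius of univalence $R_{\mathcal{S}}(\mathcal{F}_i)$ equals the radius of starlikeness $R_{\mathcal{S}^*}(\mathcal{F}_i)$, and both are equal to the smallest positive zero of $P_i$. Numerically, $R_{\mathcal{S}}(\mathcal{F}_1)\approx 0.210756$, $R_{\mathcal{S}}(\mathcal{F}_2)\approx 0.248032$, $R_{\mathcal{S}}(\mathcal{F}_3)\approx 0.347296$.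
   Context: Notation: $\mathbb{D}_r=\{z\in\mathbb{C}:|z|<r\}$ and $\mathbb{D}=\mathbb{D}_1$. $\mathcal{A}$ is the set of analytic functions $f:\mathbb{D}\to\mathbb{C}$ with $f(0)=0$ and $f'(0)=1$. $\mathcal{S}\subset\mathcal{A}$ is the subclass of univalent (injective) functions. Quotients such as $f(z)/g(z)$ and $g(z)/(z+z^2/2)$ are understood at $z=0$ by their analytic extension (value $1$). $\mathcal{S}^*$ (starlike functions) is the class of $f\in\mathcal{S}$ with $\operatorname{Re}(zf'(z)/f(z))>0$ for all $z\in\mathbb{D}$ (the quotient having value $1$ at $z=0$). Radius: for a class $\mathcal{F}\subset\mathcal{A}$ and a class $\mathcal{G}\subset\mathcal{A}$ characterised by a property, the $\mathcal{G}$-radius $R_{\mathcal{G}}(\mathcal{F})$ is the largest number $R\in[0,1]$ such that every $f\in\mathcal{F}$ has the property defining $\mathcal{G}$ in the disk $\mathbb{D}_r$ for each $0<r<R$; that is, the function $z\mapsto r^{-1}f(rz)$ on $\mathbb{D}$ belongs to $\mathcal{G}$ for each $0<r<R$. The radius of univalence is $R_{\mathcal{S}}(\mathcal{F})$ and the radius of starlikeness is $R_{\mathcal{S}^*}(\mathcal{F})$. The decimal values are approximate numerical values only. *)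

theory Defs
  imports "HOL-Complex_Analysis.Complex_Analysis"
begin

text \<open>
  Functions on the open unit disk are represented by total functions on the complex plane. All
  notions below depend only on the restriction to \<open>ball 0 1\<close>.
\<close>

definition class_A :: "(complex \<Rightarrow> complex) set" where
  "class_A = {f. f holomorphic_on ball 0 1 \<and> f 0 = 0 \<and> deriv f 0 = 1}"

definition class_S :: "(complex \<Rightarrow> complex) set" where
  "class_S = {f \<in> class_A. inj_on f (ball 0 1)}"

text \<open>
  The quotient of two functions with a simple zero of derivative 1 at the origin; the value 1 there
  is that of the analytic extension. At a zero \<open>z \<noteq> 0\<close> of the denominator the expression is \<open>0\<close>,
  which violates each of the inequalities imposed on quotients below.
\<close>

definition quot :: "(complex \<Rightarrow> complex) \<Rightarrow> (complex \<Rightarrow> complex) \<Rightarrow> complex \<Rightarrow> complex" where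
  "quot f g z = (if z = 0 then 1 else f z / g z)"

definition class_Sstar :: "(complex \<Rightarrow> complex) set" where
  "class_Sstar = {f \<in> class_S. \<forall>z \<in> ball 0 1. Re (quot (\<lambda>w. w * deriv f w) f z) > 0}"

definition rescale :: "real \<Rightarrow> (complex \<Rightarrow> complex) \<Rightarrow> complex \<Rightarrow> complex" where
  "rescale r f = (\<lambda>z. f (of_real r * z) / of_real r)"

definition radius :: "(complex \<Rightarrow> complex) set \<Rightarrow> (complex \<Rightarrow> complex) set \<Rightarrow> real" where
  "radius \<G> \<F> =
     (GREATEST R. R \<in> {0..1} \<and> (\<forall>f \<in> \<F>. \<forall>r. 0 < r \<and> r < R \<longrightarrow> rescale r f \<in> \<G>))"

text \<open>The greatest such number always exists.\<close>

lemma radius_works: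
  shows "radius \<G> \<F> \<in> {0..1}"
    and "\<lbrakk>f \<in> \<F>; 0 < r; r < radius \<G> \<F>\<rbrakk> \<Longrightarrow> rescale r f \<in> \<G>"
    and "\<lbrakk>R \<in> {0..1}; \<And>f r. \<lbrakk>f \<in> \<F>; 0 < r; r < R\<rbrakk> \<Longrightarrow> rescale r f \<in> \<G>\<rbrakk> \<Longrightarrow> R \<le> radius \<G> \<F>"
proof -
  define P where
    "P = (\<lambda>R. R \<in> {0..1} \<and> (\<forall>f \<in> \<F>. \<forall>r. 0 < r \<and> r < R \<longrightarrow> rescale r f \<in> \<G>))"
  define M where "M = Sup (Collect P)"
  have P0: "P 0" by (auto simp: P_def)
  have bdd: "bdd_above (Collect P)"
    by (rule bdd_aboveI[of _ 1]) (simp add: P_def)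
  have upper: "R \<le> M" if "P R" for R
    unfolding M_def using that bdd by (intro cSup_upper) auto
  have "M \<le> 1"
    unfolding M_def
    by (rule cSup_least) (use P0 in blast, simp add: P_def)
  moreover have "rescale r f \<in> \<G>" if f: "f \<in> \<F>" and r: "0 < r" "r < M" for f r
  proof -
    obtain R where "P R" "r < R"
      using r(2) P0 bdd unfolding M_def by (subst (asm) less_cSup_iff) auto
    with f r(1) show ?thesis by (auto simp: P_def)
  qed
  ultimately have PM: "P M"
    using upper[OF P0] by (auto simp: P_def)
  have eq: "radius \<G> \<F> = M"
    unfolding radius_def P_def[symmetric]
    by (rule Greatest_equality) (use PM upper in \<open>auto simp: P_def\<close>)
  show "radius \<G> \<F> \<in> {0..1}"
    and "\<lbrakk>f \<in> \<F>; 0 < r; r < radius \<G> \<F>\<rbrakk> \<Longrightarrow> rescale r f \<in> \<G>"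
    using PM by (auto simp: eq P_def)
  show "R \<le> radius \<G> \<F>"
    if "R \<in> {0..1}" "\<And>f r. \<lbrakk>f \<in> \<F>; 0 < r; r < R\<rbrakk> \<Longrightarrow> rescale r f \<in> \<G>"
    using that by (auto simp: eq P_def intro!: upper)
qed

definition class_F1 :: "(complex \<Rightarrow> complex) set" where
  "class_F1 = {f \<in> class_A. \<exists>g \<in> class_A. \<forall>z \<in> ball 0 1.
     Re (quot f g z) > 0 \<and> Re (quot g (\<lambda>w. w + w\<^sup>2 / 2) z) > 0}"

definition class_F2 :: "(complex \<Rightarrow> complex) set" where
  "class_F2 = {f \<in> class_A. \<exists>g \<in> class_A. \<forall>z \<in> ball 0 1.
     norm (quot f g z - 1) < 1 \<and> Re (quot g (\<lambda>w. w + w\<^sup>2 / 2) z) > 0}"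

definition class_F3 :: "(complex \<Rightarrow> complex) set" where
  "class_F3 = {f \<in> class_A. \<forall>z \<in> ball 0 1. Re (quot f (\<lambda>w. w + w\<^sup>2 / 2) z) > 0}"

definition P1 :: "real \<Rightarrow> real" where "P1 r = 1 - 5 * r + r ^ 2 + r ^ 3"
definition P2 :: "real \<Rightarrow> real" where "P2 r = 2 - 8 * r - r ^ 2 + 3 * r ^ 3"
definition P3 :: "real \<Rightarrow> real" where "P3 r = 1 - 3 * r + r ^ 3"

definition is_smallest_pos_zero :: "(real \<Rightarrow> real) \<Rightarrow> real \<Rightarrow> bool" where
  "is_smallest_pos_zero p x \<longleftrightarrow> 0 < x \<and> p x = 0 \<and> (\<forall>y. 0 < y \<and> p y = 0 \<longrightarrow> x \<le> y)"

end

theory Submission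
  imports Defs
begin

text \<open>
  Dividing successively by \<open>g\<close> and by \<open>z + z\<^sup>2 / 2\<close> writes \<open>z f' / f\<close> as
  \<open>2 - 2 / (2 + z)\<close> plus logarithmic derivatives of the quotients. By Schwarz--Pick, on
  \<open>|z| = r\<close> a quotient of positive real part contributes at most \<open>2 r / (1 - r\<^sup>2)\<close> in modulus and one
  in the unit disk around 1 at most \<open>r / (1 - r)\<close>; the resulting lower bound for
  \<open>Re (z f' / f)\<close> is a positive multiple of \<open>P\<^sub>i r\<close>. All these estimates are attained at
  \<open>z = - r\<close> when the quotients are \<open>(1 + z) / (1 - z)\<close> and \<open>1 + z\<close>; for this \<open>f\<close> the derivative
  vanishes at minus the zero of \<open>P\<^sub>i\<close>, so already univalence fails beyond it.
\<close>

section \<open>Univalence from positivity of Re (z f' / f)\<close>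

text \<open>Noshiro-Warschawski: dividing \<open>G\<close> by \<open>b - a\<close> turns its
  derivative along the segment from \<open>a\<close> to \<open>b\<close> into \<open>deriv G\<close>
  itself, so the real part strictly increases from one end to the other and the two values cannot
  agree.\<close>

lemma inj_on_convex_if_Re_deriv_pos:
  assumes S: "convex S" "open S" and hol: "G holomorphic_on S"
    and pos: "\<And>z. z \<in> S \<Longrightarrow> Re (deriv G z) > 0"
  shows "inj_on G S"
proof (rule inj_onI, rule ccontr)
  fix a b assume ab: "a \<in> S" "b \<in> S" "G a = G b" "a \<noteq> b"
  define \<phi> where "\<phi> t = Re (G (a + of_real t * (b - a)) / (b - a))" for t
  have "\<exists>y. (\<phi> has_real_derivative y) (at t) \<and> y > 0" if "0 \<le> t" "t \<le> 1" for t
  proof -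
    have mem: "a + of_real t * (b - a) \<in> S"
      using convexD_alt[OF S(1) ab(1,2) that] by (simp add: scaleR_conv_of_real algebra_simps)
    have "((\<lambda>t. a + of_real t * (b - a)) has_vector_derivative (b - a)) (at t)"
      by (auto intro!: derivative_eq_intros)
    from field_vector_diff_chain_at[OF this holomorphic_derivI[OF hol S(2) mem]]
    have "((\<lambda>t. G (a + of_real t * (b - a))) has_vector_derivative
        (b - a) * deriv G (a + of_real t * (b - a))) (at t)"
      by (simp add: o_def)
    then have "((\<lambda>t. Re (G (a + of_real t * (b - a)) / (b - a))) has_vector_derivative
        Re ((b - a) * deriv G (a + of_real t * (b - a)) / (b - a))) (at t)"
      by (intro bounded_linear.has_vector_derivative[OF bounded_linear_Re]
          bounded_linear.has_vector_derivative[OF bounded_linear_divide])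
    with ab(4) pos[OF mem] show ?thesis
      unfolding \<phi>_def has_real_derivative_iff_has_vector_derivative by auto
  qed
  then have "\<phi> 0 < \<phi> 1"
    by (rule DERIV_pos_imp_increasing[OF zero_less_one])
  with ab show False by (simp add: \<phi>_def)
qed

text \<open>The singularities of f(z)/z and g(z)/z at 0 are removable, with value the derivative 1
  there; \<open>quot f g\<close> is the quotient of these two extensions, and the denominator is 1
  at the origin.\<close>

lemma quot_holomorphic:
  assumes f: "f \<in> class_A" and g: "g \<in> class_A"
    and S: "open S" "S \<subseteq> ball 0 1" and nz: "\<And>z. z \<in> S \<Longrightarrow> z \<noteq> 0 \<Longrightarrow> g z \<noteq> 0"
  shows "quot f g holomorphic_on S"
proof -
  have *: "quot h id holomorphic_on S" if "h \<in> class_A" for h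
    by (rule pole_theorem_open_0[where g = h and a = 0])
      (use that S in \<open>auto simp: class_A_def quot_def intro: holomorphic_on_subset\<close>)
  have "(\<lambda>z. quot f id z / quot g id z) holomorphic_on S"
    using nz by (intro holomorphic_on_divide * f g) (auto simp: quot_def)
  also have "(\<lambda>z. quot f id z / quot g id z) = quot f g"
    by (auto simp: quot_def fun_eq_iff)
  finally show ?thesis .
qed

lemma id_in_class_A: "id \<in> class_A"
  by (auto simp: class_A_def id_def intro!: DERIV_imp_deriv)

text \<open>
  In the coordinate \<open>u = log z\<close> the map \<open>f\<close> becomes \<open>G u = log (f (exp u))\<close> on a half-plane, and
  \<open>deriv G u\<close> is the quotient \<open>z f'(z) / f(z)\<close>.
\<close>

lemma starlike_imp_inj_on:
  assumes f: "f \<in> class_A" and R: "0 < R" "R \<le> 1"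
    and pos: "\<And>z. z \<noteq> 0 \<Longrightarrow> norm z < R \<Longrightarrow> Re (z * deriv f z / f z) > 0"
  shows "inj_on f (ball 0 R)"
proof -
  have sub: "ball 0 R \<subseteq> (ball 0 1 :: complex set)" using R by auto
  have f0: "f 0 = 0" and holf: "f holomorphic_on ball 0 R"
    using f sub by (auto simp: class_A_def intro: holomorphic_on_subset)
  have nz: "f z \<noteq> 0" if "z \<noteq> 0" "norm z < R" for z
    using pos[OF that] by auto
  \<comment> \<open>Dividing out the simple zero at 0 leaves a zero-free function on a disk, which
    has a holomorphic logarithm \<open>L\<close>.\<close>
  define h where "h = quot f id"
  have hol_h: "h holomorphic_on ball 0 R"
    unfolding h_def by (intro quot_holomorphic f id_in_class_A sub) auto
  have h_nz: "h z \<noteq> 0" if "z \<in> ball 0 R" for z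
    using nz[of z] that by (auto simp: h_def quot_def)
  have fh: "f z = z * h z" for z using f0 by (auto simp: h_def quot_def)
  obtain L where L: "L holomorphic_on ball 0 R" "\<And>z. z \<in> ball 0 R \<Longrightarrow> exp (L z) = h z"
    using holomorphic_logarithm_exists[OF convex_ball open_ball hol_h h_nz, of 0] R by auto
  \<comment> \<open>\<open>exp\<close> maps this half-plane onto the punctured disk; unlike the
    latter it is convex, as the injectivity criterion demands.\<close>
  define H where "H = {u. Re u < ln R}"
  have mem: "exp u \<in> ball 0 R" if "u \<in> H" for u
  proof -
    have "exp (Re u) < exp (ln R)" using that by (simp add: H_def del: exp_ln)
    then show ?thesis using R by simp
  qed
  define G where "G u = u + L (exp u)" for u
  have H: "convex H" "open H"
    unfolding H_def by (rule convex_halfspace_Re_lt, rule open_halfspace_Re_lt)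
  have "(L \<circ> exp) holomorphic_on H"
    using mem by (intro holomorphic_on_compose_gen[OF holomorphic_on_exp L(1)]) auto
  then have hol_G: "G holomorphic_on H"
    unfolding G_def o_def by (intro holomorphic_intros)
  have exp_G: "exp (G u) = f (exp u)" if "u \<in> H" for u
    using L(2)[OF mem[OF that]] by (simp add: G_def exp_add fh)
  have "Re (deriv G u) > 0" if u: "u \<in> H" for u
  proof -
    have "((\<lambda>u. f (exp u)) has_field_derivative deriv f (exp u) * exp u) (at u)"
      by (rule DERIV_chain2[OF holomorphic_derivI[OF holf open_ball mem[OF u]] DERIV_exp])
    moreover have "((\<lambda>u. exp (G u)) has_field_derivative exp (G u) * deriv G u) (at u)"
      by (rule DERIV_chain2[OF DERIV_exp holomorphic_derivI[OF hol_G H(2) u]])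
    then have "((\<lambda>u. f (exp u)) has_field_derivative exp (G u) * deriv G u) (at u)"
      by (rule has_field_derivative_transform_within_open[OF _ H(2) u exp_G])
    ultimately have "deriv f (exp u) * exp u = f (exp u) * deriv G u"
      using DERIV_unique exp_G[OF u] by metis
    then have "deriv G u = exp u * deriv f (exp u) / f (exp u)"
      using nz[of "exp u"] mem[OF u] by (simp add: field_simps)
    then show ?thesis using pos[of "exp u"] mem[OF u] by simp
  qed
  then have inj_G: "inj_on G H"
    by (intro inj_on_convex_if_Re_deriv_pos H hol_G)
  show ?thesis
  proof (rule inj_onI)
    fix z w assume zw: "z \<in> ball 0 R" "w \<in> ball 0 R" "f z = f w"
    show "z = w"
    proof (cases "z = 0 \<or> w = 0")
      case True
      then show ?thesis using zw nz f0 by (metis mem_ball_0)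
    next
      case False
      define u v where "u = Ln z" and "v = Ln w"
      have uv: "exp u = z" "exp v = w" using False by (auto simp: u_def v_def)
      have "u \<in> H" "v \<in> H"
        using False zw R by (auto simp: H_def u_def v_def)
      with uv zw exp_G have "exp (G u) = exp (G v)" by simp
      then obtain n :: int where n: "G u = G v + of_int (2 * n) * pi * \<i>"
        by (auto simp: exp_eq)
      \<comment> \<open>The logarithms of f z and f w agree only up to a period. Shifting
        \<open>v\<close> by that period fixes \<open>exp v\<close>, hence also
        \<open>L (exp v)\<close>, and moves \<open>G\<close> by exactly the missing amount.\<close>
      define v' where "v' = v + of_int (2 * n) * pi * \<i>"
      have "exp v' = exp v" unfolding v'_def exp_eq by auto
      moreover have "v' \<in> H" using \<open>v \<in> H\<close> by (simp add: v'_def H_def)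
      moreover from \<open>exp v' = exp v\<close> n have "G u = G v'" by (simp add: G_def v'_def)
      ultimately have "u = v'"
        using \<open>u \<in> H\<close> by (auto dest: inj_onD[OF inj_G])
      with \<open>exp v' = exp v\<close> uv show ?thesis by simp
    qed
  qed
qed

section \<open>Rescaling and the comparison of the two radii\<close>

lemma deriv_rescale:
  assumes "f \<in> class_A" "0 < r" "r \<le> 1" "norm z < 1"
  shows "deriv (rescale r f) z = deriv f (of_real r * z)"
proof -
  have "norm (of_real r * z) < 1"
    using assms mult_left_le_one_le[of "norm z" r] by (simp add: norm_mult)
  then have "(f has_field_derivative deriv f (of_real r * z)) (at (of_real r * z))"
    using assms by (intro holomorphic_derivI[of _ "ball 0 1"]) (auto simp: class_A_def)
  then have "(rescale r f has_field_derivative deriv f (of_real r * z) * of_real r / of_real r) (at z)"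
    unfolding rescale_def
    by (intro DERIV_cdivide DERIV_chain2[where g = "\<lambda>z. of_real r * z"] )
      (auto intro!: derivative_eq_intros)
  then show ?thesis using assms by (auto dest: DERIV_imp_deriv)
qed

lemma rescale_in_class_A:
  assumes "f \<in> class_A" "0 < r" "r \<le> 1"
  shows "rescale r f \<in> class_A"
proof -
  have "of_real r * z \<in> ball (0::complex) 1" if "z \<in> ball 0 1" for z
    using that assms mult_left_le_one_le[of "norm z" r] by (auto simp: norm_mult)
  then have "(f \<circ> (\<lambda>z. of_real r * z)) holomorphic_on ball 0 1"
    using assms
    by (intro holomorphic_on_compose_gen[where t = "ball 0 1"])
      (auto simp: class_A_def intro!: holomorphic_intros)
  then have "rescale r f holomorphic_on ball 0 1"
    unfolding rescale_def o_def using assms by (intro holomorphic_intros) auto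
  moreover have "deriv (rescale r f) 0 = 1"
    using deriv_rescale[OF assms, of 0] assms by (simp add: class_A_def)
  ultimately show ?thesis
    using assms by (auto simp: class_A_def rescale_def)
qed

text \<open>The expression z f' / f is invariant under rescaling: its value for
  \<open>rescale r f\<close> at z is its value for f at r z.\<close>

lemma rescale_in_class_Sstar:
  assumes f: "f \<in> class_A" and r: "0 < r" "r \<le> 1"
    and pos: "\<And>z. z \<noteq> 0 \<Longrightarrow> norm z < r \<Longrightarrow> Re (z * deriv f z / f z) > 0"
  shows "rescale r f \<in> class_Sstar"
proof -
  have scaled: "of_real r * z \<in> ball 0 r" if "z \<in> ball 0 1" for z :: complex
    using that r by (simp add: norm_mult)
  have "inj_on f (ball 0 r)"
    using starlike_imp_inj_on[OF f r pos] .
  then have "inj_on (rescale r f) (ball 0 1)"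
  proof (intro inj_onI)
    fix z w :: complex
    assume zw: "z \<in> ball 0 1" "w \<in> ball 0 1" "rescale r f z = rescale r f w"
    then have "f (of_real r * z) = f (of_real r * w)"
      using r by (simp add: rescale_def)
    with \<open>inj_on f (ball 0 r)\<close> have "of_real r * z = of_real r * w"
      using scaled[OF zw(1)] scaled[OF zw(2)] by (rule inj_onD)
    then show "z = w" using r by simp
  qed
  moreover have "Re (quot (\<lambda>w. w * deriv (rescale r f) w) (rescale r f) z) > 0"
    if z: "z \<in> ball 0 1" for z
  proof (cases "z = 0")
    case False
    then have "z * deriv (rescale r f) z / rescale r f z =
        (of_real r * z) * deriv f (of_real r * z) / f (of_real r * z)"
      using deriv_rescale[OF f r, of z] z r by (simp add: rescale_def)
    then show ?thesis
      using False pos[of "of_real r * z"] scaled[OF z] r by (simp add: quot_def)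
  qed (simp add: quot_def)
  ultimately show ?thesis
    using rescale_in_class_A[OF f r] by (simp add: class_Sstar_def class_S_def)
qed

text \<open>A chain of inequalities closes up: positivity up to \<open>R\<close> bounds the
  starlikeness radius from below, the inclusion of the classes puts it below the univalence radius,
  and the critical point of \<open>f0\<close> at \<open>- R\<close> bounds the latter by
  \<open>R\<close>.\<close>

lemma radii_eqI:
  assumes sub: "\<F> \<subseteq> class_A" and R: "0 < R" "R < 1"
    and pos: "\<And>f z. f \<in> \<F> \<Longrightarrow> z \<noteq> 0 \<Longrightarrow> norm z < R \<Longrightarrow> Re (z * deriv f z / f z) > 0"
    and f0: "f0 \<in> \<F>" "deriv f0 (- of_real R) = 0"
  shows "radius class_S \<F> = R" "radius class_Sstar \<F> = R"
proof -
  have Sstar_sub: "class_Sstar \<subseteq> class_S" by (auto simp: class_Sstar_def)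
  have lower: "R \<le> radius class_Sstar \<F>"
    using R sub pos by (intro radius_works(3) rescale_in_class_Sstar) auto
  have le: "radius class_Sstar \<F> \<le> radius class_S \<F>"
  proof (rule radius_works(3))
    show "rescale r f \<in> class_S" if "f \<in> \<F>" "0 < r" "r < radius class_Sstar \<F>" for f r
      using radius_works(2)[OF that] Sstar_sub by blast
  qed (rule radius_works(1))
  have upper: "radius class_S \<F> \<le> R"
  proof (rule ccontr)
    assume "\<not> ?thesis"
    then obtain r where r: "R < r" "r < radius class_S \<F>"
      using dense[of R "radius class_S \<F>"] by (auto simp: not_le)
    have r1: "r \<le> 1" using r radius_works(1)[of class_S \<F>] by simp
    have A: "f0 \<in> class_A" using sub f0 by auto
    \<comment> \<open>Rescaling by \<open>r > R\<close> moves the critical point \<open>- R\<close>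
      of \<open>f0\<close> to this point inside the unit disk, whereas an injective holomorphic
      function has no critical point.\<close>
    define \<zeta> where "\<zeta> = complex_of_real (- (R / r))"
    have \<zeta>: "norm \<zeta> < 1" unfolding \<zeta>_def norm_of_real using r R by simp
    have "rescale r f0 \<in> class_S"
      using radius_works(2)[OF f0(1)] r R by auto
    then have "deriv (rescale r f0) \<zeta> \<noteq> 0"
      using \<zeta> by (intro holomorphic_injective_imp_regular[where S = "ball 0 1"])
        (auto simp: class_S_def class_A_def)
    moreover have "of_real r * \<zeta> = - of_real R" using r R by (simp add: \<zeta>_def)
    ultimately show False
      using deriv_rescale[OF A _ r1 \<zeta>] f0 r R by simp
  qed
  show "radius class_S \<F> = R" "radius class_Sstar \<F> = R"
    using lower le upper by auto
qed

section \<open>Schwarz-Pick and bounds on logarithmic derivatives\<close>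

text \<open>Composing \<open>w\<close> with disk automorphisms that move 0 to \<open>a\<close> and
  \<open>w a\<close> to 0 gives a self-map \<open>Q\<close> of the disk fixing 0. The Schwarz lemma
  bounds \<open>deriv Q 0\<close>, and the chain rule translates this back to
  \<open>deriv w a\<close>.\<close>

theorem Schwarz_Pick_deriv:
  assumes hol: "w holomorphic_on ball 0 1" and w1: "\<And>z. norm z < 1 \<Longrightarrow> norm (w z) < 1"
    and a: "norm a < 1"
  shows "norm (deriv w a) \<le> (1 - (norm (w a))\<^sup>2) / (1 - (norm a)\<^sup>2)"
proof -
  define M where "M c z = (z - c) / (1 - cnj c * z)" for c z :: complex
  have M_Moebius: "M = Moebius_function 0" by (simp add: M_def fun_eq_iff Moebius_function_simple)
  have M1: "norm (M c z) < 1" if "norm c < 1" "norm z < 1" for c z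
    using that by (simp add: M_Moebius Moebius_function_norm_lt_1)
  have holM: "M c holomorphic_on ball 0 1" if "norm c < 1" for c
    using that by (simp add: M_Moebius Moebius_function_holomorphic)
  have cnj_sq: "cnj c * c = of_real ((norm c)\<^sup>2)" for c
    by (metis complex_norm_square mult.commute of_real_power)
  have sq: "0 < 1 - (norm c)\<^sup>2" if "norm c < 1" for c :: complex
    using that by (simp add: power_less_one_iff abs_square_less_1)
  define Q where "Q = (\<lambda>\<zeta>. M (w a) (w (M (- a) \<zeta>)))"
  have "(w \<circ> M (- a)) holomorphic_on ball 0 1"
    by (rule holomorphic_on_compose_gen[OF holM hol]) (use a M1 in auto)
  then have "(M (w a) \<circ> (w \<circ> M (- a))) holomorphic_on ball 0 1"
    by (rule holomorphic_on_compose_gen[OF _ holM]) (use a w1 M1 in auto)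
  then have "Q holomorphic_on ball 0 1" by (simp add: Q_def o_def)
  moreover have "Q 0 = 0" by (simp add: Q_def M_def)
  moreover have "norm (Q \<zeta>) < 1" if "norm \<zeta> < 1" for \<zeta>
    using that a w1 M1 by (auto simp: Q_def)
  ultimately have Q1: "norm (deriv Q 0) \<le> 1"
    by (rule Schwarz_Lemma(2)[where \<xi> = 0]) auto
  let ?\<alpha> = "1 - (norm a)\<^sup>2" and ?\<beta> = "1 - (norm (w a))\<^sup>2"
  have \<beta>: "0 < ?\<beta>" and \<alpha>: "0 < ?\<alpha>" using sq w1[OF a] a by auto
  have nz: "1 - cnj (w a) * w a \<noteq> 0"
    using \<beta> unfolding cnj_sq by (metis less_irrefl of_real_eq_0_iff of_real_1 of_real_diff)
  \<comment> \<open>Two cases matter: at z = 0 the derivative is 1 - |c|^2, and at z = c it is 1 /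
    (1 - |c|^2).\<close>
  have DM: "(M c has_field_derivative (1 - cnj c * c) / (1 - cnj c * z)\<^sup>2) (at z)"
    if "1 - cnj c * z \<noteq> 0" for c z
    unfolding M_def using that
    by (auto intro!: derivative_eq_intros simp: power2_eq_square algebra_simps)
  have D1: "(M (- a) has_field_derivative of_real ?\<alpha>) (at 0)"
    using DM[of "- a" 0] cnj_sq[of a] by simp
  have D2: "(w has_field_derivative deriv w a) (at (M (- a) 0))"
    using holomorphic_derivI[OF hol, of a] a by (simp add: M_def)
  have D3: "(M (w a) has_field_derivative 1 / of_real ?\<beta>) (at (w (M (- a) 0)))"
    using DM[OF nz] nz cnj_sq[of "w a"] by (simp add: power2_eq_square M_def)
  have "(Q has_field_derivative (1 / of_real ?\<beta>) * (deriv w a * of_real ?\<alpha>)) (at 0)"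
    unfolding Q_def
    by (rule DERIV_chain2[where g = "\<lambda>\<zeta>. w (M (- a) \<zeta>)",
          OF D3 DERIV_chain2[where g = "M (- a)", OF D2 D1]])
  then have "deriv Q 0 = deriv w a * of_real (?\<alpha> / ?\<beta>)"
    by (simp add: DERIV_imp_deriv)
  then have "norm (deriv w a) * (?\<alpha> / ?\<beta>) \<le> 1"
    using Q1 \<alpha> \<beta> by (simp add: norm_mult del: of_real_divide)
  then show ?thesis using \<alpha> \<beta> by (simp add: field_simps)
qed

text \<open>The map p -> (p - p(a)) / (p + cnj (p(a))) carries the right half-plane into the disk
  and p(a) to 0, so Schwarz-Pick gives |p'(a)| / (2 Re p(a)) <= 1 / (1 - |a|^2). It remains to use
  Re p(a) <= |p(a)|.\<close>

lemma Re_pos_log_deriv_bound: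
  assumes hol: "p holomorphic_on ball 0 1" and pos: "\<And>z. norm z < 1 \<Longrightarrow> Re (p z) > 0"
    and a: "norm a < 1"
  shows "norm (a * deriv p a / p a) \<le> 2 * norm a / (1 - (norm a)\<^sup>2)"
proof -
  define w where "w z = (p z - p a) / (p z + cnj (p a))" for z
  have nz: "p z + cnj (p a) \<noteq> 0" if "norm z < 1" for z
    using pos[OF that] pos[OF a] by (auto simp: complex_eq_iff)
  have "w holomorphic_on ball 0 1"
    unfolding w_def using nz by (intro holomorphic_intros hol) auto
  moreover have "norm (w z) < 1" if "norm z < 1" for z
  proof -
    \<comment> \<open>Numerator and denominator of \<open>w z\<close> have the same imaginary part,
      so comparing the real parts suffices.\<close>
    have "(Re (p z) - Re (p a))\<^sup>2 < (Re (p z) + Re (p a))\<^sup>2"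
      using mult_pos_pos[OF pos[OF that] pos[OF a]] by (simp add: power2_eq_square algebra_simps)
    then have "norm (p z - p a) < norm (p z + cnj (p a))"
      unfolding cmod_def by simp
    then show ?thesis using nz[OF that] by (simp add: w_def norm_divide)
  qed
  ultimately have "norm (deriv w a) \<le> (1 - (norm (w a))\<^sup>2) / (1 - (norm a)\<^sup>2)"
    by (rule Schwarz_Pick_deriv[OF _ _ a])
  moreover have "(w has_field_derivative deriv p a / of_real (2 * Re (p a))) (at a)"
  proof -
    have sum: "p a + cnj (p a) = of_real (2 * Re (p a))" by (simp add: complex_add_cnj)
    have "(p has_field_derivative deriv p a) (at a)"
      using a by (intro holomorphic_derivI[OF hol]) auto
    then show ?thesis
      unfolding w_def using pos[OF a] nz[OF a]
      by (auto intro!: derivative_eq_intros simp: sum)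
  qed
  ultimately have "norm (deriv p a) / (2 * Re (p a)) \<le> 1 / (1 - (norm a)\<^sup>2)"
    using pos[OF a] by (simp add: DERIV_imp_deriv norm_divide norm_mult w_def)
  then have "norm (deriv p a) \<le> 2 * Re (p a) / (1 - (norm a)\<^sup>2)"
    using pos[OF a] by (simp add: field_simps)
  also have "\<dots> \<le> 2 * norm (p a) / (1 - (norm a)\<^sup>2)"
    using a complex_Re_le_cmod[of "p a"] by (intro divide_right_mono) (auto simp: power_le_one)
  finally have "norm a * norm (deriv p a) \<le> norm a * (2 * norm (p a) / (1 - (norm a)\<^sup>2))"
    by (rule mult_left_mono) simp
  moreover have "p a \<noteq> 0" using pos[OF a] by auto
  ultimately show ?thesis by (simp add: norm_mult norm_divide field_simps)
qed

text \<open>Schwarz-Pick for w = q - 1, with 1 - |w|^2 split into (1 - |w|) (1 + |w|): the first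
  factor is at most |q| by the triangle inequality and so cancels against the denominator of q' / q;
  the second is at most 1 + |a| by the Schwarz lemma, since w(0) = 0.\<close>

lemma near_one_log_deriv_bound:
  assumes hol: "q holomorphic_on ball 0 1" and q0: "q 0 = 1"
    and q1: "\<And>z. norm z < 1 \<Longrightarrow> norm (q z - 1) < 1" and a: "norm a < 1"
  shows "norm (a * deriv q a / q a) \<le> norm a / (1 - norm a)"
proof -
  define w where "w z = q z - 1" for z
  have holw: "w holomorphic_on ball 0 1" unfolding w_def by (intro holomorphic_intros hol)
  have w1: "norm (w z) < 1" if "norm z < 1" for z using q1[OF that] by (simp add: w_def)
  have "(w has_field_derivative deriv q a) (at a)"
    unfolding w_def using a
    by (auto intro!: derivative_eq_intros holomorphic_derivI[OF hol])
  then have "norm (deriv q a) \<le> (1 - (norm (w a))\<^sup>2) / (1 - (norm a)\<^sup>2)"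
    using Schwarz_Pick_deriv[OF holw w1 a] by (simp add: DERIV_imp_deriv)
  also have "\<dots> = (1 - norm (w a)) * ((1 + norm (w a)) / (1 - (norm a)\<^sup>2))"
    by (simp add: power2_eq_square algebra_simps)
  also have "\<dots> \<le> norm (q a) * ((1 + norm a) / (1 - (norm a)\<^sup>2))"
  proof (intro mult_mono divide_right_mono)
    show "1 - norm (w a) \<le> norm (q a)"
      using norm_triangle_ineq2[of 1 "1 - q a"] by (simp add: w_def norm_minus_commute)
    show "1 + norm (w a) \<le> 1 + norm a"
      using Schwarz_Lemma(1)[OF holw _ w1 a] q0 by (simp add: w_def)
  qed (use a in \<open>auto simp: power_le_one\<close>)
  also have "(1 + norm a) / (1 - (norm a)\<^sup>2) = 1 / (1 - norm a)"
  proof -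
    have "1 - (norm a)\<^sup>2 = (1 + norm a) * (1 - norm a)"
      by (simp add: power2_eq_square algebra_simps)
    moreover have "1 + norm a \<noteq> 0" using norm_ge_zero[of a] by linarith
    ultimately show ?thesis by simp
  qed
  finally have "norm a * norm (deriv q a) \<le> norm a * (norm (q a) * (1 / (1 - norm a)))"
    by (rule mult_left_mono) simp
  moreover have "q a \<noteq> 0" using q1[OF a] by auto
  ultimately show ?thesis by (simp add: norm_mult norm_divide field_simps)
qed

section \<open>Lower bounds for Re (z f' / f) by successive division\<close>

abbreviation base :: "complex \<Rightarrow> complex" where
  "base \<equiv> \<lambda>w. w + w\<^sup>2 / 2"

text \<open>Since f = g * \<open>quot f g\<close>, the logarithmic derivatives add; the real part of
  the second summand is at least minus its modulus.\<close>

lemma Re_log_deriv_ge: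
  assumes f: "f \<in> class_A" and g: "g \<in> class_A"
    and nz: "\<And>z. z \<noteq> 0 \<Longrightarrow> norm z < 1 \<Longrightarrow> f z \<noteq> 0 \<and> g z \<noteq> 0"
    and z: "z \<noteq> 0" "norm z < 1"
  shows "Re (z * deriv f z / f z) \<ge>
    Re (z * deriv g z / g z) - norm (z * deriv (quot f g) z / quot f g z)"
proof -
  let ?q = "quot f g"
  have zb: "z \<in> ball 0 1" using z by simp
  have "?q holomorphic_on ball 0 1"
    using nz by (intro quot_holomorphic f g) auto
  then have q': "(?q has_field_derivative deriv ?q z) (at z)"
    by (rule holomorphic_derivI[OF _ open_ball zb])
  have g': "(g has_field_derivative deriv g z) (at z)"
    using g by (intro holomorphic_derivI[OF _ open_ball zb]) (simp add: class_A_def)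
  have "g w * ?q w = f w" if "w \<in> ball 0 1" for w
    using nz[of w] that f g by (auto simp: quot_def class_A_def)
  then have "(f has_field_derivative g z * deriv ?q z + deriv g z * ?q z) (at z)"
    by (rule has_field_derivative_transform_within_open[OF DERIV_mult'[OF g' q'] open_ball zb])
  then have "deriv f z = g z * deriv ?q z + deriv g z * ?q z"
    by (rule DERIV_imp_deriv)
  then have "z * deriv f z / f z = z * deriv g z / g z + z * deriv ?q z / ?q z"
    using nz[OF z] z by (simp add: quot_def field_simps)
  then show ?thesis
    using abs_Re_le_cmod[of "z * deriv ?q z / ?q z"] by simp
qed

lemma base_eq: "base z = z * (2 + z) / 2"
  by (simp add: power2_eq_square algebra_simps)

lemma two_plus_nonzero: "norm z < 1 \<Longrightarrow> 2 + z \<noteq> (0 :: complex)"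
  by (auto simp: add_eq_0_iff)

lemma base_nonzero: "z \<noteq> 0 \<Longrightarrow> norm z < 1 \<Longrightarrow> base z \<noteq> 0"
  unfolding base_eq using two_plus_nonzero by simp

lemma DERIV_base: "(base has_field_derivative 1 + z) (at z)"
  by (auto intro!: derivative_eq_intros)

lemma base_in_class_A: "base \<in> class_A"
  using DERIV_imp_deriv[OF DERIV_base, of 0]
  by (auto simp: class_A_def intro!: holomorphic_intros)

text \<open>The quotient is exactly 2 - 2 / (2 + z), and |2 + z| >= 2 - |z|. Equality holds at z =
  -|z|, the direction in which the extremal functions degenerate.\<close>

lemma Re_log_deriv_base_ge:
  assumes "z \<noteq> 0" "norm z < 1"
  shows "Re (z * deriv base z / base z) \<ge> 2 - 2 / (2 - norm z)"
proof -
  have nz: "2 + z \<noteq> 0" by (rule two_plus_nonzero[OF assms(2)])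
  have "z * deriv base z / base z = 2 - 2 / (2 + z)"
    unfolding DERIV_imp_deriv[OF DERIV_base] unfolding base_eq
    using assms nz by (simp add: divide_simps)
  moreover have "Re (2 / (2 + z)) \<le> 2 / norm (2 + z)"
    using complex_Re_le_cmod[of "2 / (2 + z)"] by (simp add: norm_divide)
  moreover have "2 / norm (2 + z) \<le> 2 / (2 - norm z)"
    using assms nz norm_triangle_ineq2[of 2 "- z"]
    by (intro divide_left_mono mult_pos_pos) auto
  ultimately show ?thesis by (simp only: minus_complex.sel) simp
qed

text \<open>Allows the extremal functions to be built factor by factor, starting from
  \<open>base\<close>.\<close>

lemma mult_in_class_A:
  assumes g: "g \<in> class_A" and p: "p holomorphic_on ball 0 1" "p 0 = 1"
  shows "(\<lambda>z. g z * p z) \<in> class_A"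
proof -
  have "(g has_field_derivative 1) (at 0)" "(p has_field_derivative deriv p 0) (at 0)"
    using holomorphic_derivI[OF p(1) open_ball, of 0] holomorphic_derivI[of g "ball 0 1" 0] g
    by (auto simp: class_A_def)
  from DERIV_imp_deriv[OF DERIV_mult'[OF this]] show ?thesis
    using assms by (auto simp: class_A_def intro!: holomorphic_intros)
qed

lemma quot_mult_cancel: "p 0 = 1 \<Longrightarrow> (z \<noteq> 0 \<Longrightarrow> g z \<noteq> 0) \<Longrightarrow> quot (\<lambda>z. g z * p z) g z = p z"
  by (simp add: quot_def)

text \<open>Division by zero yields 0, so a zero of either function would give the quotient the
  value 0, which has no positive real part.\<close>

lemma Re_pos_quot_nonzero: "Re (quot f g z) > 0 \<Longrightarrow> z \<noteq> 0 \<Longrightarrow> f z \<noteq> 0 \<and> g z \<noteq> 0"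
  by (auto simp: quot_def)

text \<open>As before, a zero of either function makes the quotient 0, at distance exactly 1 from
  1.\<close>

lemma near_one_quot_nonzero: "norm (quot f g z - 1) < 1 \<Longrightarrow> z \<noteq> 0 \<Longrightarrow> f z \<noteq> 0 \<and> g z \<noteq> 0"
  by (auto simp: quot_def)

text \<open>One division step of the estimate, used both for f over g and with \<open>base\<close>
  as the denominator.\<close>

lemma Re_log_deriv_ge_if_Re_pos:
  assumes f: "f \<in> class_A" and g: "g \<in> class_A"
    and pos: "\<And>z. norm z < 1 \<Longrightarrow> Re (quot f g z) > 0"
    and z: "z \<noteq> 0" "norm z < 1"
  shows "Re (z * deriv f z / f z) \<ge> Re (z * deriv g z / g z) - 2 * norm z / (1 - (norm z)\<^sup>2)"
proof -
  have nz: "f z \<noteq> 0 \<and> g z \<noteq> 0" if "z \<noteq> 0" "norm z < 1" for z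
    using Re_pos_quot_nonzero[OF pos] that by blast
  have "quot f g holomorphic_on ball 0 1"
    using nz by (intro quot_holomorphic f g) auto
  then have "norm (z * deriv (quot f g) z / quot f g z) \<le> 2 * norm z / (1 - (norm z)\<^sup>2)"
    by (rule Re_pos_log_deriv_bound[OF _ pos z(2)])
  moreover have "Re (z * deriv f z / f z) \<ge>
      Re (z * deriv g z / g z) - norm (z * deriv (quot f g) z / quot f g z)"
    by (rule Re_log_deriv_ge[OF f g nz z])
  ultimately show ?thesis by linarith
qed

lemma Re_log_deriv_ge_if_near_one:
  assumes f: "f \<in> class_A" and g: "g \<in> class_A"
    and near: "\<And>z. norm z < 1 \<Longrightarrow> norm (quot f g z - 1) < 1"
    and z: "z \<noteq> 0" "norm z < 1"
  shows "Re (z * deriv f z / f z) \<ge> Re (z * deriv g z / g z) - norm z / (1 - norm z)"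
proof -
  have nz: "f z \<noteq> 0 \<and> g z \<noteq> 0" if "z \<noteq> 0" "norm z < 1" for z
    using near_one_quot_nonzero[OF near] that by blast
  have "quot f g holomorphic_on ball 0 1"
    using nz by (intro quot_holomorphic f g) auto
  then have "norm (z * deriv (quot f g) z / quot f g z) \<le> norm z / (1 - norm z)"
    by (rule near_one_log_deriv_bound[OF _ _ near z(2)]) (simp_all add: quot_def)
  moreover have "Re (z * deriv f z / f z) \<ge>
      Re (z * deriv g z / g z) - norm (z * deriv (quot f g) z / quot f g z)"
    by (rule Re_log_deriv_ge[OF f g nz z])
  ultimately show ?thesis by linarith
qed

section \<open>The half-plane map\<close>

abbreviation half_plane_map :: "complex \<Rightarrow> complex" where
  "half_plane_map \<equiv> \<lambda>z. (1 + z) / (1 - z)"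

text \<open>The real part equals (1 - |z|^2) / |1 - z|^2.\<close>

lemma Re_half_plane_map_pos:
  assumes "norm z < 1"
  shows "Re (half_plane_map z) > 0"
proof -
  have "(Re z)\<^sup>2 + (Im z)\<^sup>2 < 1"
    using assms by (simp add: cmod_def)
  moreover have "z \<noteq> 1" using assms by auto
  then have "(1 - Re z)\<^sup>2 + (Im z)\<^sup>2 > 0"
    by (auto simp: complex_eq_iff sum_power2_gt_zero_iff)
  ultimately show ?thesis
    by (simp add: Re_divide power2_eq_square algebra_simps)
qed

lemma half_plane_map_holomorphic: "half_plane_map holomorphic_on ball 0 1"
  by (auto intro!: holomorphic_intros)

lemma DERIV_half_plane_map:
  "z \<noteq> 1 \<Longrightarrow> (half_plane_map has_field_derivative 2 / (1 - z)\<^sup>2) (at z)"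
  by (auto intro!: derivative_eq_intros simp: power2_eq_square field_simps)

section \<open>Smallest positive zeros of the three cubics\<close>

text \<open>The sign change gives a zero in the bracket, and strict decrease on [0, 1] makes the
  function positive before it, so no smaller positive zero exists.\<close>

lemma decreasing_zero:
  fixes p :: "real \<Rightarrow> real"
  assumes cont: "continuous_on {a..b} p" and ab: "0 < a" "a \<le> b" "b \<le> 1"
    and sign: "p a \<ge> 0" "p b \<le> 0"
    and decr: "\<And>x y. 0 \<le> x \<Longrightarrow> x < y \<Longrightarrow> y \<le> 1 \<Longrightarrow> p y < p x"
  obtains x where "a \<le> x" "x \<le> b" "p x = 0" "is_smallest_pos_zero p x"
    "\<And>r. 0 \<le> r \<Longrightarrow> r < x \<Longrightarrow> p r > 0"
proof -
  obtain x where x: "a \<le> x" "x \<le> b" "p x = 0"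
    using IVT2'[OF sign(2,1) ab(2) cont] by auto
  then have pos: "p r > 0" if "0 \<le> r" "r < x" for r
    using decr[of r x] that ab by auto
  then have "is_smallest_pos_zero p x"
    unfolding is_smallest_pos_zero_def using x ab by (metis less_irrefl less_le not_le order_trans)
  with x pos that show thesis by blast
qed

lemma P1_decreasing: "0 \<le> x \<Longrightarrow> x < y \<Longrightarrow> y \<le> 1 \<Longrightarrow> P1 y < P1 x"
  and P2_decreasing: "0 \<le> x \<Longrightarrow> x < y \<Longrightarrow> y \<le> 1 \<Longrightarrow> P2 y < P2 x"
  and P3_decreasing: "0 \<le> x \<Longrightarrow> x < y \<Longrightarrow> y \<le> 1 \<Longrightarrow> P3 y < P3 x"
proof -
  assume xy: "0 \<le> x" "x < y" "y \<le> 1"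
  \<comment> \<open>Each difference of values at x and y is \<open>y - x\<close> times a cofactor.
    These bounds make the cofactors at least 5 - 3x - 2y, 8 - 5x - 2y and 3 - 2x - y, all positive
    because x < y <= 1.\<close>
  have sq: "x\<^sup>2 \<le> x" "y\<^sup>2 \<le> y" "x * y \<le> x"
    using xy mult_left_le[of x x] mult_left_le[of y y] mult_left_le[of y x]
    by (auto simp: power2_eq_square)
  have "0 < 5 - (x + y) - (x\<^sup>2 + x * y + y\<^sup>2)"
    and "0 < 8 + (x + y) - 3 * (x\<^sup>2 + x * y + y\<^sup>2)"
    and "0 < 3 - (x\<^sup>2 + x * y + y\<^sup>2)"
    using xy sq unfolding distrib_left by linarith+
  then have "0 < (y - x) * (5 - (x + y) - (x\<^sup>2 + x * y + y\<^sup>2))"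
    and "0 < (y - x) * (8 + (x + y) - 3 * (x\<^sup>2 + x * y + y\<^sup>2))"
    and "0 < (y - x) * (3 - (x\<^sup>2 + x * y + y\<^sup>2))"
    using xy by simp_all
  then show "P1 y < P1 x" "P2 y < P2 x" "P3 y < P3 x"
    by (simp_all add: P1_def P2_def P3_def power2_eq_square power3_eq_cube algebra_simps)
qed

section \<open>Sharp radii of the three classes\<close>

text \<open>This product is the extremal function of \<open>class_F3\<close> and the intermediate
  function \<open>g\<close> for the extremal functions of \<open>class_F1\<close> and
  \<open>class_F2\<close>.\<close>

lemma base_mult_half_plane_map:
  fixes g defines "g \<equiv> \<lambda>z. base z * half_plane_map z"
  shows "g \<in> class_A" and "z \<in> ball 0 1 \<Longrightarrow> quot g base z = half_plane_map z"
    and "z \<in> ball 0 1 \<Longrightarrow> z \<noteq> 0 \<Longrightarrow> g z \<noteq> 0"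
proof -
  show "g \<in> class_A"
    unfolding g_def by (intro mult_in_class_A base_in_class_A half_plane_map_holomorphic) simp
  show "quot g base z = half_plane_map z" if "z \<in> ball 0 1"
    unfolding g_def using that by (intro quot_mult_cancel base_nonzero) auto
  show "g z \<noteq> 0" if "z \<in> ball 0 1" "z \<noteq> 0"
    unfolding g_def using base_nonzero[of z] Re_half_plane_map_pos[of z] that
    by (metis less_irrefl mem_ball_0 mult_eq_0_iff zero_complex.sel(1))
qed

lemma radii_F1:
  assumes R: "0 < R" "R < 1" and zero: "P1 R = 0" and pos: "\<And>r. 0 \<le> r \<Longrightarrow> r < R \<Longrightarrow> P1 r > 0"
  shows "radius class_S class_F1 = R" "radius class_Sstar class_F1 = R"
proof -
  let ?p = half_plane_map
  \<comment> \<open>For the half-plane map, z p' / p = 2 z / (1 - z^2), which at z = -r is the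
    negative of the general bound; \<open>?f\<close> carries one such factor for each of the two
    quotients.\<close>
  let ?g = "\<lambda>z. base z * ?p z" and ?f = "\<lambda>z. base z * ?p z * ?p z"
  have sub: "class_F1 \<subseteq> class_A" by (auto simp: class_F1_def)
  have star: "Re (z * deriv f z / f z) > 0" if f: "f \<in> class_F1" and z: "z \<noteq> 0" "norm z < R" for f z
  proof -
    define r where "r = norm z"
    have r: "0 \<le> r" "r < 1" using z R by (auto simp: r_def)
    obtain g where g: "g \<in> class_A" "\<And>z. norm z < 1 \<Longrightarrow> Re (quot f g z) > 0"
      "\<And>z. norm z < 1 \<Longrightarrow> Re (quot g base z) > 0"
      using f unfolding class_F1_def by auto
    have "Re (z * deriv f z / f z) \<ge> Re (z * deriv g z / g z) - 2 * r / (1 - r\<^sup>2)"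
      unfolding r_def using f sub g z R by (intro Re_log_deriv_ge_if_Re_pos) auto
    moreover have "Re (z * deriv g z / g z) \<ge> Re (z * deriv base z / base z) - 2 * r / (1 - r\<^sup>2)"
      unfolding r_def using g z R by (intro Re_log_deriv_ge_if_Re_pos base_in_class_A) auto
    moreover have "Re (z * deriv base z / base z) \<ge> 2 - 2 / (2 - r)"
      unfolding r_def using z R by (intro Re_log_deriv_base_ge) auto
    moreover have "2 - 2 / (2 - r) - 2 * (2 * r / (1 - r\<^sup>2)) > 0"
    proof -
      have nz: "0 < 2 - r" "0 < 1 - r\<^sup>2" using r by (auto simp: power_less_one_iff)
      then have "2 - 2 / (2 - r) - 2 * (2 * r / (1 - r\<^sup>2)) = 2 * P1 r / ((2 - r) * (1 - r\<^sup>2))"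
        by (simp add: P1_def field_simps power2_eq_square power3_eq_cube)
      also have "\<dots> > 0" using nz pos[of r] z r by (simp add: r_def)
      finally show ?thesis .
    qed
    ultimately show ?thesis by linarith
  qed
  have "?f \<in> class_F1"
  proof -
    have "?f \<in> class_A"
      by (intro mult_in_class_A base_mult_half_plane_map half_plane_map_holomorphic) simp
    moreover have "quot ?f ?g z = ?p z" if "z \<in> ball 0 1" for z
      using base_mult_half_plane_map(3)[OF that] by (intro quot_mult_cancel) auto
    ultimately show ?thesis
      unfolding class_F1_def using Re_half_plane_map_pos base_mult_half_plane_map(1,2)
      by (auto intro!: bexI[of _ ?g])
  qed
  moreover have "deriv ?f (- of_real R) = 0"
  proof (rule DERIV_imp_deriv)
    define c where "c = complex_of_real R"
    have c: "1 + c \<noteq> 0" "- c \<noteq> 1" "2 + c * 2 \<noteq> 0"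
      using R unfolding c_def by (auto simp: complex_eq_iff)
    have P: "1 - 5 * c + c ^ 2 + c ^ 3 = 0"
      using arg_cong[OF zero, of complex_of_real] by (simp add: P1_def c_def)
    note D = DERIV_half_plane_map[OF c(2)]
    \<comment> \<open>The left side is the product rule for \<open>?f\<close> at \<open>- c\<close>,
      nested as the factors of \<open>?f\<close> are; over a common denominator the cubic
      \<open>P1\<close> at \<open>c\<close> splits off.\<close>
    have "base (- c) * ?p (- c) * (2 / (1 - (- c))\<^sup>2) +
        (base (- c) * (2 / (1 - (- c))\<^sup>2) + (1 + - c) * ?p (- c)) * ?p (- c)
        = (1 - c) * (1 - 5 * c + c ^ 2 + c ^ 3) / (1 + c) ^ 3"
      using c by (simp add: divide_simps) (simp add: algebra_simps power2_eq_square power3_eq_cube)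
    with P DERIV_mult'[OF DERIV_mult'[OF DERIV_base D] D]
    show "(?f has_field_derivative 0) (at (- of_real R))"
      by (simp only: c_def[symmetric]) simp
  qed
  ultimately show "radius class_S class_F1 = R" "radius class_Sstar class_F1 = R"
    using radii_eqI[OF sub R star] by blast+
qed

lemma radii_F2:
  assumes R: "0 < R" "R < 1" and zero: "P2 R = 0" and pos: "\<And>r. 0 \<le> r \<Longrightarrow> r < R \<Longrightarrow> P2 r > 0"
  shows "radius class_S class_F2 = R" "radius class_Sstar class_F2 = R"
proof -
  let ?p = half_plane_map
  \<comment> \<open>The factor 1 + z lies in the unit disk around 1, and its logarithmic derivative
    z / (1 + z) equals -r / (1 - r) at z = -r, which attains the bound for such quotients.\<close>
  let ?g = "\<lambda>z. base z * ?p z" and ?f = "\<lambda>z. base z * ?p z * (1 + z)"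
  have sub: "class_F2 \<subseteq> class_A" by (auto simp: class_F2_def)
  have star: "Re (z * deriv f z / f z) > 0" if f: "f \<in> class_F2" and z: "z \<noteq> 0" "norm z < R" for f z
  proof -
    define r where "r = norm z"
    have r: "0 \<le> r" "r < 1" using z R by (auto simp: r_def)
    obtain g where g: "g \<in> class_A" "\<And>z. norm z < 1 \<Longrightarrow> norm (quot f g z - 1) < 1"
      "\<And>z. norm z < 1 \<Longrightarrow> Re (quot g base z) > 0"
      using f unfolding class_F2_def by auto
    have "Re (z * deriv f z / f z) \<ge> Re (z * deriv g z / g z) - r / (1 - r)"
      unfolding r_def using f sub g z R by (intro Re_log_deriv_ge_if_near_one) auto
    moreover have "Re (z * deriv g z / g z) \<ge> Re (z * deriv base z / base z) - 2 * r / (1 - r\<^sup>2)"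
      unfolding r_def using g z R by (intro Re_log_deriv_ge_if_Re_pos base_in_class_A) auto
    moreover have "Re (z * deriv base z / base z) \<ge> 2 - 2 / (2 - r)"
      unfolding r_def using z R by (intro Re_log_deriv_base_ge) auto
    moreover have "2 - 2 / (2 - r) - 2 * r / (1 - r\<^sup>2) - r / (1 - r) > 0"
    proof -
      have nz: "0 < 2 - r" "0 < 1 - r" "0 < 1 + r" using r by auto
      have sq: "1 - r\<^sup>2 = (1 - r) * (1 + r)" by (simp add: power2_eq_square algebra_simps)
      have "2 - 2 / (2 - r) - 2 * r / (1 - r\<^sup>2) - r / (1 - r)
          = P2 r / ((2 - r) * ((1 - r) * (1 + r)))"
        unfolding sq using nz by (simp add: divide_simps P2_def)
          (simp add: algebra_simps power2_eq_square power3_eq_cube)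
      also have "\<dots> > 0" using nz pos[of r] z r by (simp add: r_def)
      finally show ?thesis .
    qed
    ultimately show ?thesis by linarith
  qed
  have "?f \<in> class_F2"
  proof -
    have "?f \<in> class_A"
      by (intro mult_in_class_A base_mult_half_plane_map holomorphic_intros) simp
    moreover have "quot ?f ?g z = 1 + z" if "z \<in> ball 0 1" for z
      using base_mult_half_plane_map(3)[OF that] by (intro quot_mult_cancel) auto
    ultimately show ?thesis
      unfolding class_F2_def using Re_half_plane_map_pos base_mult_half_plane_map(1,2)
      by (auto intro!: bexI[of _ ?g])
  qed
  moreover have "deriv ?f (- of_real R) = 0"
  proof (rule DERIV_imp_deriv)
    define c where "c = complex_of_real R"
    have c: "1 + c \<noteq> 0" "- c \<noteq> 1" "2 + c * 2 \<noteq> 0"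
      using R unfolding c_def by (auto simp: complex_eq_iff)
    have P: "2 - 8 * c - c ^ 2 + 3 * c ^ 3 = 0"
      using arg_cong[OF zero, of complex_of_real] by (simp add: P2_def c_def)
    have D1: "((\<lambda>z. 1 + z) has_field_derivative 1) (at (- c))"
      by (auto intro!: derivative_eq_intros)
    have "base (- c) * ?p (- c) * 1 +
        (base (- c) * (2 / (1 - (- c))\<^sup>2) + (1 + - c) * ?p (- c)) * (1 + - c)
        = (1 - c) * (2 - 8 * c - c ^ 2 + 3 * c ^ 3) / (2 * (1 + c) ^ 2)"
      using c by (simp add: divide_simps) (simp add: algebra_simps power2_eq_square power3_eq_cube)
    with P DERIV_mult'[OF DERIV_mult'[OF DERIV_base DERIV_half_plane_map[OF c(2)]] D1]
    show "(?f has_field_derivative 0) (at (- of_real R))"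
      by (simp only: c_def[symmetric]) simp
  qed
  ultimately show "radius class_S class_F2 = R" "radius class_Sstar class_F2 = R"
    using radii_eqI[OF sub R star] by blast+
qed

lemma radii_F3:
  assumes R: "0 < R" "R < 1" and zero: "P3 R = 0" and pos: "\<And>r. 0 \<le> r \<Longrightarrow> r < R \<Longrightarrow> P3 r > 0"
  shows "radius class_S class_F3 = R" "radius class_Sstar class_F3 = R"
proof -
  let ?p = half_plane_map
  let ?f = "\<lambda>z. base z * ?p z"
  have sub: "class_F3 \<subseteq> class_A" by (auto simp: class_F3_def)
  have star: "Re (z * deriv f z / f z) > 0" if f: "f \<in> class_F3" and z: "z \<noteq> 0" "norm z < R" for f z
  proof -
    define r where "r = norm z"
    have r: "0 \<le> r" "r < 1" using z R by (auto simp: r_def)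
    have "Re (quot f base z) > 0" if "norm z < 1" for z
      using f that unfolding class_F3_def by auto
    then have "Re (z * deriv f z / f z) \<ge> Re (z * deriv base z / base z) - 2 * r / (1 - r\<^sup>2)"
      unfolding r_def using f sub z R by (intro Re_log_deriv_ge_if_Re_pos base_in_class_A) auto
    moreover have "Re (z * deriv base z / base z) \<ge> 2 - 2 / (2 - r)"
      unfolding r_def using z R by (intro Re_log_deriv_base_ge) auto
    moreover have "2 - 2 / (2 - r) - 2 * r / (1 - r\<^sup>2) > 0"
    proof -
      have nz: "0 < 2 - r" "0 < 1 - r\<^sup>2" using r by (auto simp: power_less_one_iff)
      then have "2 - 2 / (2 - r) - 2 * r / (1 - r\<^sup>2) = 2 * P3 r / ((2 - r) * (1 - r\<^sup>2))"
        by (simp add: P3_def field_simps power2_eq_square power3_eq_cube)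
      also have "\<dots> > 0" using nz pos[of r] z r by (simp add: r_def)
      finally show ?thesis .
    qed
    ultimately show ?thesis by linarith
  qed
  have "?f \<in> class_F3"
    unfolding class_F3_def using Re_half_plane_map_pos base_mult_half_plane_map(1,2) by auto
  moreover have "deriv ?f (- of_real R) = 0"
  proof (rule DERIV_imp_deriv)
    define c where "c = complex_of_real R"
    have c: "1 + c \<noteq> 0" "- c \<noteq> 1" "2 + c * 2 \<noteq> 0"
      using R unfolding c_def by (auto simp: complex_eq_iff)
    have P: "1 - 3 * c + c ^ 3 = 0"
      using arg_cong[OF zero, of complex_of_real] by (simp add: P3_def c_def)
    have "base (- c) * (2 / (1 - (- c))\<^sup>2) + (1 + - c) * ?p (- c)
        = (1 - 3 * c + c ^ 3) / (1 + c)\<^sup>2"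
      using c by (simp add: divide_simps) (simp add: algebra_simps power2_eq_square power3_eq_cube)
    with P DERIV_mult'[OF DERIV_base DERIV_half_plane_map[OF c(2)]]
    show "(?f has_field_derivative 0) (at (- of_real R))"
      by (simp only: c_def[symmetric]) simp
  qed
  ultimately show "radius class_S class_F3 = R" "radius class_Sstar class_F3 = R"
    using radii_eqI[OF sub R star] by blast+
qed

theorem mainTheorem4:
  shows "(radius class_S class_F1 = radius class_Sstar class_F1
       \<and> is_smallest_pos_zero P1 (radius class_S class_F1)
       \<and> \<bar>radius class_S class_F1 - 0.210756\<bar> \<le> 0.0000005)
     \<and> (radius class_S class_F2 = radius class_Sstar class_F2
       \<and> is_smallest_pos_zero P2 (radius class_S class_F2)
       \<and> \<bar>radius class_S class_F2 - 0.248032\<bar> \<le> 0.0000005)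
     \<and> (radius class_S class_F3 = radius class_Sstar class_F3
       \<and> is_smallest_pos_zero P3 (radius class_S class_F3)
       \<and> \<bar>radius class_S class_F3 - 0.347296\<bar> \<le> 0.0000005)"
proof (intro conjI)
  \<comment> \<open>The bracket is the stated decimal plus or minus 0.0000005, so locating the zero
    also proves the numerical estimate; likewise for \<open>R2\<close> and
    \<open>R3\<close>.\<close>
  obtain R1 where R1: "0.2107555 \<le> R1" "R1 \<le> 0.2107565" "P1 R1 = 0" "is_smallest_pos_zero P1 R1"
    "\<And>r. 0 \<le> r \<Longrightarrow> r < R1 \<Longrightarrow> P1 r > 0"
    by (rule decreasing_zero[of "0.2107555" "0.2107565" P1])
      (auto simp: P1_decreasing, auto simp: P1_def power2_eq_square power3_eq_cube
        intro!: continuous_intros)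
  then have F1: "radius class_S class_F1 = R1" "radius class_Sstar class_F1 = R1"
    using radii_F1[of R1] by auto
  obtain R2 where R2: "0.2480315 \<le> R2" "R2 \<le> 0.2480325" "P2 R2 = 0" "is_smallest_pos_zero P2 R2"
    "\<And>r. 0 \<le> r \<Longrightarrow> r < R2 \<Longrightarrow> P2 r > 0"
    by (rule decreasing_zero[of "0.2480315" "0.2480325" P2])
      (auto simp: P2_decreasing, auto simp: P2_def power2_eq_square power3_eq_cube
        intro!: continuous_intros)
  then have F2: "radius class_S class_F2 = R2" "radius class_Sstar class_F2 = R2"
    using radii_F2[of R2] by auto
  obtain R3 where R3: "0.3472955 \<le> R3" "R3 \<le> 0.3472965" "P3 R3 = 0" "is_smallest_pos_zero P3 R3"
    "\<And>r. 0 \<le> r \<Longrightarrow> r < R3 \<Longrightarrow> P3 r > 0"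
    by (rule decreasing_zero[of "0.3472955" "0.3472965" P3])
      (auto simp: P3_decreasing, auto simp: P3_def power2_eq_square power3_eq_cube
        intro!: continuous_intros)
  then have F3: "radius class_S class_F3 = R3" "radius class_Sstar class_F3 = R3"
    using radii_F3[of R3] by auto
  show "radius class_S class_F1 = radius class_Sstar class_F1"
    "radius class_S class_F2 = radius class_Sstar class_F2"
    "radius class_S class_F3 = radius class_Sstar class_F3"
    by (simp_all add: F1 F2 F3)
  show "is_smallest_pos_zero P1 (radius class_S class_F1)"
    "is_smallest_pos_zero P2 (radius class_S class_F2)"
    "is_smallest_pos_zero P3 (radius class_S class_F3)"
    using R1(4) R2(4) R3(4) by (simp_all add: F1 F2 F3)
  show "\<bar>radius class_S class_F1 - 0.210756\<bar> \<le> 0.0000005"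
    "\<bar>radius class_S class_F2 - 0.248032\<bar> \<le> 0.0000005"
    "\<bar>radius class_S class_F3 - 0.347296\<bar> \<le> 0.0000005"
    using R1(1,2) R2(1,2) R3(1,2) unfolding F1 F2 F3 abs_le_iff by simp_all
qed

end
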